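(* The $\mathbb F$-algebra $\Re$ has a presentation given by generators $A,B,C,D,\alpha,\beta$ and relations $$BA=AB-2D,\qquad CB=BC-2D,\qquad CA=AC+2D,$$ $$DA=AD-BA+AC-\alpha,\qquad DB=BD-CB+BA-\beta,$$ $$\alpha A=A\alpha,\quad \alpha B=B\alpha,\quad \alpha C=C\alpha,\qquad \beta A=A\beta,\quad \beta B=B\beta,\quad \beta C=C\beta.$$ That is, the $\mathbb F$-algebra defined by these generators and relations is isomorphic to $\Re$ via the map sending each generator to the element of $\Re$ of the same name.
   Context: $\mathbb F$ is a field with $\operatorname{char}\mathbb F\neq 2$. All algebras are unital and associative. Write $[x,y]=xy-yx$. The Racah algebra $\Re$ is the $\mathbb F$-algebra defined by generators $A,B,C,D$ and the relations $[A,B]=[B,C]=[C,A]=2D$ together with the relations asserting that each of the elements $$\alpha=[A,D]+AC-BA,\qquad \beta=[B,D]+BA-CB,\qquad \gamma=[C,D]+CB-AC$$ is central in $\Re$. *)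

theory Defs
  imports
    "HOL-Library.Poly_Mapping"
    "HOL-Computational_Algebra.Polynomial"
    "HOL-Algebra.QuotRing"
    "HOL-Algebra.Module"
begin

section \<open>Free algebras\<close>

text \<open>
  Lists form the free monoid under concatenation. With this instance the finitely supported
  functions \<^typ>\<open>'g list \<Rightarrow>\<^sub>0 'k\<close> carry the convolution product of \<^theory>\<open>HOL-Library.Poly_Mapping\<close>,
  which makes them the monoid algebra of the free monoid, i.e. the free unital associative
  \<open>'k\<close>-algebra on the type \<open>'g\<close> of generators.
\<close>

instantiation list :: (type) monoid_add
begin

definition zero_list :: "'a list" where "zero_list = []"

definition plus_list :: "'a list \<Rightarrow> 'a list \<Rightarrow> 'a list" where "plus_list = (@)"

instance by standard (simp_all add: zero_list_def plus_list_def)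

end

definition gen :: "'g \<Rightarrow> ('g list \<Rightarrow>\<^sub>0 'k::field)"
  where "gen g = Poly_Mapping.single [g] 1"

text \<open>
  An \<open>'k\<close>-algebra is represented by the record type \<open>module\<close> of HOL-Algebra, which extends \<open>ring\<close>
  by a scalar multiplication. (The locale \<open>algebra\<close> of HOL-Algebra covers commutative algebras
  only.)
\<close>

definition free_algebra :: "('k::field, 'g list \<Rightarrow>\<^sub>0 'k) module"
  where "free_algebra =
    \<lparr>carrier = UNIV, mult = (*), one = 1, zero = 0, add = (+),
     smult = (\<lambda>c. Poly_Mapping.map ((*) c))\<rparr>"

section \<open>Algebras given by generators and relations\<close>

text \<open>A pair \<open>(u, v)\<close> stands for the relation \<open>u = v\<close>; ideals of HOL-Algebra are two-sided.\<close>

definition relation_ideal :: "(('g list \<Rightarrow>\<^sub>0 'k::field) \<times> ('g list \<Rightarrow>\<^sub>0 'k)) set \<Rightarrow> ('g list \<Rightarrow>\<^sub>0 'k) set"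
  where "relation_ideal rels = Idl\<^bsub>free_algebra\<^esub> {u - v | u v. (u, v) \<in> rels}"

definition rel_class ::
    "(('g list \<Rightarrow>\<^sub>0 'k::field) \<times> ('g list \<Rightarrow>\<^sub>0 'k)) set \<Rightarrow> ('g list \<Rightarrow>\<^sub>0 'k) \<Rightarrow> ('g list \<Rightarrow>\<^sub>0 'k) set"
  where "rel_class rels u = relation_ideal rels +>\<^bsub>free_algebra\<^esub> u"

definition presented_algebra ::
    "(('g list \<Rightarrow>\<^sub>0 'k::field) \<times> ('g list \<Rightarrow>\<^sub>0 'k)) set \<Rightarrow> ('k, ('g list \<Rightarrow>\<^sub>0 'k) set) module"
  where "presented_algebra rels =
    ring.extend (free_algebra Quot relation_ideal rels)
      (module.fields (\<lambda>c K. \<Union>u\<in>K. rel_class rels (c \<odot>\<^bsub>free_algebra\<^esub> u)))"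

definition algebra_iso ::
    "('k, 'a) module \<Rightarrow> ('k, 'b) module \<Rightarrow> ('a \<Rightarrow> 'b) set"
  where "algebra_iso R S =
    {h \<in> ring_iso R S. \<forall>c. \<forall>x\<in>carrier R. h (c \<odot>\<^bsub>R\<^esub> x) = c \<odot>\<^bsub>S\<^esub> h x}"

subsection \<open>Well-definedness of the presented algebra\<close>

lemma ring_free_algebra: "ring (free_algebra :: ('k::field, 'g list \<Rightarrow>\<^sub>0 'k) module)"
proof (rule ringI)
  show "abelian_group (free_algebra :: ('k, 'g list \<Rightarrow>\<^sub>0 'k) module)"
    by (rule abelian_groupI)
       (auto simp: free_algebra_def add.assoc add.commute intro: exI[of _ "- _"] left_minus)
  show "Group.monoid (free_algebra :: ('k, 'g list \<Rightarrow>\<^sub>0 'k) module)"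
    by (rule monoidI) (auto simp: free_algebra_def mult.assoc)
qed (auto simp: free_algebra_def algebra_simps)

lemma ideal_relation_ideal: "ideal (relation_ideal rels) free_algebra"
  unfolding relation_ideal_def
  by (rule ring.genideal_ideal[OF ring_free_algebra]) (simp add: free_algebra_def)

lemma carrier_presented_algebra: "carrier (presented_algebra rels) = range (rel_class rels)"
  by (auto simp: presented_algebra_def ring.extend_def FactRing_def A_RCOSETS_def'
      rel_class_def free_algebra_def)

lemma rel_class_eq_iff: "rel_class rels u = rel_class rels v \<longleftrightarrow> u - v \<in> relation_ideal rels"
proof -
  interpret ideal "relation_ideal rels" free_algebra by (rule ideal_relation_ideal)
  have neg: "\<ominus>\<^bsub>free_algebra\<^esub> v = - v"
    by (rule minus_equality) (auto simp: free_algebra_def)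
  have "u \<ominus>\<^bsub>free_algebra\<^esub> v = u - v"
    by (simp add: a_minus_def neg) (simp add: free_algebra_def)
  thus ?thesis
    using quotient_eq_iff_same_a_r_cos[OF ideal_relation_ideal, of u v]
    by (simp add: rel_class_def free_algebra_def)
qed

lemma presented_algebra_ops:
  "rel_class rels u \<oplus>\<^bsub>presented_algebra rels\<^esub> rel_class rels v = rel_class rels (u + v)"
  "rel_class rels u \<otimes>\<^bsub>presented_algebra rels\<^esub> rel_class rels v = rel_class rels (u * v)"
  "\<one>\<^bsub>presented_algebra rels\<^esub> = rel_class rels 1"
  "\<zero>\<^bsub>presented_algebra rels\<^esub> = rel_class rels 0"
  "c \<odot>\<^bsub>presented_algebra rels\<^esub> rel_class rels u = rel_class rels (Poly_Mapping.map ((*) c) u)"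
proof -
  interpret ideal "relation_ideal rels" free_algebra by (rule ideal_relation_ideal)
  let ?F = "free_algebra :: ('b, 'a list \<Rightarrow>\<^sub>0 'b) module"
  show "rel_class rels u \<oplus>\<^bsub>presented_algebra rels\<^esub> rel_class rels v = rel_class rels (u + v)"
    using a_rcos_sum[of u v]
    by (simp add: presented_algebra_def ring.extend_def FactRing_def rel_class_def free_algebra_def)
  show "rel_class rels u \<otimes>\<^bsub>presented_algebra rels\<^esub> rel_class rels v = rel_class rels (u * v)"
    using rcoset_mult_add[of u v]
    by (simp add: presented_algebra_def ring.extend_def FactRing_def rel_class_def free_algebra_def)
  show "\<one>\<^bsub>presented_algebra rels\<^esub> = rel_class rels 1"
    by (simp add: presented_algebra_def ring.extend_def FactRing_def rel_class_def)
       (simp add: free_algebra_def)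
  show "\<zero>\<^bsub>presented_algebra rels\<^esub> = rel_class rels 0"
    by (simp add: presented_algebra_def ring.extend_def FactRing_def rel_class_def
        free_algebra_def a_r_coset_def r_coset_def)
  have cls: "rel_class rels (c \<odot>\<^bsub>free_algebra\<^esub> w) = rel_class rels (Poly_Mapping.map ((*) c) u)"
    if "w \<in> rel_class rels u" for w
  proof -
    from that have "\<exists>i\<in>relation_ideal rels. w = i + u"
      by (simp add: rel_class_def a_r_coset_def r_coset_def) (simp add: free_algebra_def)
    then obtain i where i: "i \<in> relation_ideal rels" "w = i + u" by blast
    have "Poly_Mapping.map ((*) c) w - Poly_Mapping.map ((*) c) u = Poly_Mapping.single 0 c * i"
      by (simp add: mult_map_scale_conv_mult i(2) algebra_simps)
    also have "\<dots> \<in> relation_ideal rels"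
      using I_l_closed[OF i(1), of "Poly_Mapping.single 0 c"] by (simp add: free_algebra_def)
    finally show ?thesis by (simp add: rel_class_eq_iff) (simp add: free_algebra_def)
  qed
  moreover have "u \<in> rel_class rels u"
    using a_rcos_self[of u] by (simp add: rel_class_def free_algebra_def)
  ultimately have "(\<Union>w\<in>rel_class rels u. rel_class rels (c \<odot>\<^bsub>free_algebra\<^esub> w)) =
      rel_class rels (Poly_Mapping.map ((*) c) u)"
    by blast
  thus "c \<odot>\<^bsub>presented_algebra rels\<^esub> rel_class rels u =
      rel_class rels (Poly_Mapping.map ((*) c) u)"
    by (simp add: presented_algebra_def ring.extend_def module.fields_def)
qed

lemma ring_presented_algebra: "ring (presented_algebra rels)"
proof (rule ringI)
  show "abelian_group (presented_algebra rels)"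
  proof (rule abelian_groupI)
    fix x assume "x \<in> carrier (presented_algebra rels)"
    then obtain u where "x = rel_class rels u" by (auto simp: carrier_presented_algebra)
    thus "\<exists>y\<in>carrier (presented_algebra rels). y \<oplus>\<^bsub>presented_algebra rels\<^esub> x = \<zero>\<^bsub>presented_algebra rels\<^esub>"
      by (intro bexI[of _ "rel_class rels (- u)"])
         (auto simp: carrier_presented_algebra presented_algebra_ops)
  qed (auto simp: carrier_presented_algebra presented_algebra_ops add_ac)
  show "Group.monoid (presented_algebra rels)"
    by (rule monoidI) (auto simp: carrier_presented_algebra presented_algebra_ops mult.assoc)
qed (auto simp: carrier_presented_algebra presented_algebra_ops algebra_simps)

section \<open>The Racah algebra\<close>

definition commutator :: "'r::ring \<Rightarrow> 'r \<Rightarrow> 'r"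
  where "commutator x y = x * y - y * x"

datatype racah_gen = gA | gB | gC | gD

abbreviation rA :: "racah_gen list \<Rightarrow>\<^sub>0 'k::field" where "rA \<equiv> gen gA"
abbreviation rB :: "racah_gen list \<Rightarrow>\<^sub>0 'k::field" where "rB \<equiv> gen gB"
abbreviation rC :: "racah_gen list \<Rightarrow>\<^sub>0 'k::field" where "rC \<equiv> gen gC"
abbreviation rD :: "racah_gen list \<Rightarrow>\<^sub>0 'k::field" where "rD \<equiv> gen gD"

definition r\<alpha> :: "racah_gen list \<Rightarrow>\<^sub>0 'k::field"
  where "r\<alpha> = commutator rA rD + rA * rC - rB * rA"

definition r\<beta> :: "racah_gen list \<Rightarrow>\<^sub>0 'k::field"
  where "r\<beta> = commutator rB rD + rB * rA - rC * rB"

definition r\<gamma> :: "racah_gen list \<Rightarrow>\<^sub>0 'k::field"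
  where "r\<gamma> = commutator rC rD + rC * rB - rA * rC"

text \<open>
  Centrality is imposed literally: \<open>x\<close> ranges over the whole free algebra, hence its class over the
  whole quotient.
\<close>

definition racah_relations :: "((racah_gen list \<Rightarrow>\<^sub>0 'k::field) \<times> (racah_gen list \<Rightarrow>\<^sub>0 'k)) set"
  where "racah_relations =
    {(commutator rA rB, 2 * rD), (commutator rB rC, 2 * rD), (commutator rC rA, 2 * rD)} \<union>
    {(z * x, x * z) | z x. z \<in> {r\<alpha>, r\<beta>, r\<gamma>}}"

definition racah_algebra :: "('k::field, (racah_gen list \<Rightarrow>\<^sub>0 'k) set) module"
  where "racah_algebra = presented_algebra racah_relations"

section \<open>The second presentation\<close>

text \<open>
  Here \<open>\<alpha>\<close> and \<open>\<beta>\<close> are free generators, unlike \<^const>\<open>r\<alpha>\<close> and \<^const>\<open>r\<beta>\<close>.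
\<close>

datatype pres_gen = hA | hB | hC | hD | h\<alpha> | h\<beta>

abbreviation pA :: "pres_gen list \<Rightarrow>\<^sub>0 'k::field" where "pA \<equiv> gen hA"
abbreviation pB :: "pres_gen list \<Rightarrow>\<^sub>0 'k::field" where "pB \<equiv> gen hB"
abbreviation pC :: "pres_gen list \<Rightarrow>\<^sub>0 'k::field" where "pC \<equiv> gen hC"
abbreviation pD :: "pres_gen list \<Rightarrow>\<^sub>0 'k::field" where "pD \<equiv> gen hD"
abbreviation p\<alpha> :: "pres_gen list \<Rightarrow>\<^sub>0 'k::field" where "p\<alpha> \<equiv> gen h\<alpha>"
abbreviation p\<beta> :: "pres_gen list \<Rightarrow>\<^sub>0 'k::field" where "p\<beta> \<equiv> gen h\<beta>"

definition pres_relations :: "((pres_gen list \<Rightarrow>\<^sub>0 'k::field) \<times> (pres_gen list \<Rightarrow>\<^sub>0 'k)) set"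
  where "pres_relations =
    {(pB * pA, pA * pB - 2 * pD),
     (pC * pB, pB * pC - 2 * pD),
     (pC * pA, pA * pC + 2 * pD),
     (pD * pA, pA * pD - pB * pA + pA * pC - p\<alpha>),
     (pD * pB, pB * pD - pC * pB + pB * pA - p\<beta>),
     (p\<alpha> * pA, pA * p\<alpha>), (p\<alpha> * pB, pB * p\<alpha>), (p\<alpha> * pC, pC * p\<alpha>),
     (p\<beta> * pA, pA * p\<beta>), (p\<beta> * pB, pB * p\<beta>), (p\<beta> * pC, pC * p\<beta>)}"

definition pres_algebra :: "('k::field, (pres_gen list \<Rightarrow>\<^sub>0 'k) set) module"
  where "pres_algebra = presented_algebra pres_relations"

end

theory Submission
  imports Defs
begin

text \<open>
  Modulo either set of relations \<open>A + B + C\<close> commutes with \<open>A\<close> and \<open>B\<close>, hence with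
  \<open>2 D = [A, B]\<close> and, since \<open>2\<close> is invertible, with \<open>D\<close>. As
  \<open>\<alpha> + \<beta> + \<gamma> = [A + B + C, D]\<close> identically, \<open>\<gamma> = - \<alpha> - \<beta>\<close> modulo the relations, so the
  centrality of \<open>\<gamma>\<close> is redundant. Likewise an element commuting with \<open>A\<close>, \<open>B\<close> and \<open>C\<close> commutes with
  \<open>D\<close>, and then with \<open>\<alpha>\<close> and \<open>\<beta>\<close>, which are polynomials in \<open>A\<close>, \<open>B\<close>, \<open>C\<close>, \<open>D\<close>.
\<close>

section \<open>Substitution in free algebras\<close>

lemma poly_mapping_sum_monomials:
  "(\<Sum>w\<in>Poly_Mapping.keys u. Poly_Mapping.single w (Poly_Mapping.lookup u w)) = u"
  by (rule poly_mapping_eqI) (auto simp: lookup_sum lookup_single when_def in_keys_iff)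

text \<open>Every element is a finite sum of scalar multiples of words, and a word is a product of
  generators.\<close>

lemma free_algebra_induct [case_names const gen add mult]:
  fixes u :: "'g list \<Rightarrow>\<^sub>0 'k::field"
  assumes const: "\<And>c. P (Poly_Mapping.single 0 c)"
    and gen: "\<And>g. P (gen g)"
    and add: "\<And>u v. P u \<Longrightarrow> P v \<Longrightarrow> P (u + v)"
    and mult: "\<And>u v. P u \<Longrightarrow> P v \<Longrightarrow> P (u * v)"
  shows "P u"
proof -
  have single: "P (Poly_Mapping.single w c)" for w c
  proof (induction w)
    case Nil
    show ?case using const[of c] by (simp add: zero_list_def)
  next
    case (Cons g w)
    have "Poly_Mapping.single (g # w) c = gen g * Poly_Mapping.single w c"
      by (simp add: gen_def mult_single plus_list_def)
    thus ?case using mult[OF gen Cons.IH] by simp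
  qed
  have "P (\<Sum>w\<in>A. Poly_Mapping.single w (Poly_Mapping.lookup u w))" if "finite A" for A
    using that
  proof (induction A rule: finite_induct)
    case empty
    show ?case using const[of 0] by simp
  next
    case (insert w A)
    then show ?case using add[OF single insert.IH] by simp
  qed
  from this[OF finite_keys[of u]] show ?thesis by (simp add: poly_mapping_sum_monomials)
qed

text \<open>The algebra homomorphism given by the universal property of the free algebra. Since
  \<open>0\<close> is the empty word, \<open>Poly_Mapping.single 0 c\<close> is the scalar
  \<open>c\<close>.\<close>

definition subst :: "('g \<Rightarrow> ('h list \<Rightarrow>\<^sub>0 'k)) \<Rightarrow> ('g list \<Rightarrow>\<^sub>0 'k::field) \<Rightarrow> ('h list \<Rightarrow>\<^sub>0 'k)"
  where "subst f u =
    (\<Sum>w\<in>Poly_Mapping.keys u. Poly_Mapping.single 0 (Poly_Mapping.lookup u w) * prod_list (map f w))"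

text \<open>Allows sums for elements with different supports to run over one common index
  set.\<close>

lemma subst_superset:
  assumes "finite A" "Poly_Mapping.keys u \<subseteq> A"
  shows "subst f u = (\<Sum>w\<in>A. Poly_Mapping.single 0 (Poly_Mapping.lookup u w) * prod_list (map f w))"
  unfolding subst_def using assms
  by (intro sum.mono_neutral_left) (auto simp: in_keys_iff)

lemma subst_single:
  "subst f (Poly_Mapping.single w c) = Poly_Mapping.single 0 c * prod_list (map f w)"
  by (subst subst_superset[where A = "{w}"]) (auto split: if_splits)

lemma subst_gen [simp]: "subst f (gen g) = f g"
  by (simp add: gen_def subst_single)

lemma subst_const [simp]: "subst f (Poly_Mapping.single 0 c) = Poly_Mapping.single 0 c"
  by (simp add: subst_single) (simp add: zero_list_def)

lemma subst_add [simp]: "subst f (u + v) = subst f u + subst f v"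
proof -
  let ?A = "Poly_Mapping.keys u \<union> Poly_Mapping.keys v"
  have "subst f x = (\<Sum>w\<in>?A. Poly_Mapping.single 0 (Poly_Mapping.lookup x w) * prod_list (map f w))"
    if "x \<in> {u, v, u + v}" for x
    using that Poly_Mapping.keys_add[of u v] by (intro subst_superset) auto
  thus ?thesis by (simp add: lookup_add single_add distrib_right sum.distrib)
qed

lemma subst_zero [simp]: "subst f 0 = 0"
  by (simp add: subst_def)

lemma single_zero_commute:
  fixes u :: "'g list \<Rightarrow>\<^sub>0 'k::field"
  shows "Poly_Mapping.single 0 c * u = u * Poly_Mapping.single 0 c"
proof (induction u rule: free_algebra_induct)
  case (mult u v)
  then show ?case by (metis mult.assoc)
qed (simp_all add: gen_def mult_single mult.commute algebra_simps)

lemma lookup_const_mult: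
  "Poly_Mapping.lookup (Poly_Mapping.single 0 c * u) w = c * Poly_Mapping.lookup u w"
  for u :: "'g list \<Rightarrow>\<^sub>0 'k::field"
  by (simp add: Poly_Mapping.map.rep_eq when_def flip: mult_map_scale_conv_mult)

lemma const_mult_assoc:
  "Poly_Mapping.single 0 (c * d) * u = Poly_Mapping.single 0 c * (Poly_Mapping.single 0 d * u)"
  for u :: "'g list \<Rightarrow>\<^sub>0 'k::field"
  by (simp add: mult_single flip: mult.assoc)

text \<open>Induction on the left factor with \<open>v\<close> arbitrary: only scalars and
  generators need computation; sums and products follow by distributivity and associativity.\<close>

lemma subst_mult [simp]: "subst f (u * v) = subst f u * subst f v"
proof (induction u arbitrary: v rule: free_algebra_induct)
  case (const c)
  show ?case
  proof -
    have "subst f (Poly_Mapping.single 0 c * v) = Poly_Mapping.single 0 c * subst f v"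
      by (subst subst_superset[where A = "Poly_Mapping.keys v"])
         (auto simp: subst_def sum_distrib_left lookup_const_mult const_mult_assoc in_keys_iff)
    thus ?thesis by simp
  qed
next
  case (gen g)
  \<comment> \<open>Multiplying a monomial by a generator prepends a letter to its word; centrality
    of scalars then moves the coefficient past \<open>f g\<close>. Additivity extends this to all
    \<open>v\<close>.\<close>
  have single: "subst f (gen g * Poly_Mapping.single w c) = f g * subst f (Poly_Mapping.single w c)"
    for w c
    by (simp add: gen_def mult_single plus_list_def subst_single mult.assoc single_zero_commute)
  have "subst f (gen g * (\<Sum>w\<in>A. Poly_Mapping.single w (h w))) =
      f g * subst f (\<Sum>w\<in>A. Poly_Mapping.single w (h w))" if "finite A" for A h
    using that by (induction A rule: finite_induct) (simp_all add: distrib_left single)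
  from this[OF finite_keys[of v], of "Poly_Mapping.lookup v"] show ?case
    by (simp add: poly_mapping_sum_monomials)
qed (simp_all add: distrib_right mult.assoc)

lemma subst_uminus [simp]: "subst f (- u) = - subst f u"
  using subst_add[of f u "- u"] by (simp add: eq_neg_iff_add_eq_0 add.commute)

lemma subst_diff [simp]: "subst f (u - v) = subst f u - subst f v"
  using subst_add[of f u "- v"] by simp

lemma subst_one [simp]: "subst f 1 = 1"
  using subst_const[of f 1] by simp

lemma subst_two [simp]: "subst f 2 = 2"
  using subst_add[of f 1 1] by simp

lemma subst_scale:
  "subst f (Poly_Mapping.map ((*) c) u) = Poly_Mapping.map ((*) c) (subst f u)"
  by (simp add: mult_map_scale_conv_mult)

section \<open>Relation ideals and induced isomorphisms\<close>

lemma relation_ideal_zero: "0 \<in> relation_ideal R"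
proof -
  interpret ideal "relation_ideal R" free_algebra by (rule ideal_relation_ideal)
  show ?thesis using additive_subgroup.zero_closed[OF additive_subgroup_axioms] by (simp add: free_algebra_def)
qed

lemma relation_ideal_add:
  "x \<in> relation_ideal R \<Longrightarrow> y \<in> relation_ideal R \<Longrightarrow> x + y \<in> relation_ideal R"
proof -
  interpret ideal "relation_ideal R" free_algebra by (rule ideal_relation_ideal)
  show "x \<in> relation_ideal R \<Longrightarrow> y \<in> relation_ideal R \<Longrightarrow> x + y \<in> relation_ideal R"
    using additive_subgroup.a_closed[OF additive_subgroup_axioms, of x y] by (simp add: free_algebra_def)
qed

lemma relation_ideal_mult:
  assumes "x \<in> relation_ideal R"
  shows relation_ideal_mult_left: "y * x \<in> relation_ideal R"
    and relation_ideal_mult_right: "x * y \<in> relation_ideal R"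
proof -
  interpret ideal "relation_ideal R" free_algebra by (rule ideal_relation_ideal)
  show "y * x \<in> relation_ideal R" "x * y \<in> relation_ideal R"
    using I_l_closed[OF assms, of y] I_r_closed[OF assms, of y] by (simp_all add: free_algebra_def)
qed

lemma relation_ideal_uminus: "x \<in> relation_ideal R \<Longrightarrow> - x \<in> relation_ideal R"
  using relation_ideal_mult_left[of x R "- 1"] by simp

lemma relation_ideal_diff:
  "x \<in> relation_ideal R \<Longrightarrow> y \<in> relation_ideal R \<Longrightarrow> x - y \<in> relation_ideal R"
  using relation_ideal_add[OF _ relation_ideal_uminus, of x R y] by simp

lemmas relation_ideal_closed =
  relation_ideal_add relation_ideal_diff relation_ideal_uminus
  relation_ideal_mult_left relation_ideal_mult_right

lemma relation_ideal_rel: "(u, v) \<in> R \<Longrightarrow> u - v \<in> relation_ideal R"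
  using ring.genideal_self[OF ring_free_algebra, of "{u - v | u v. (u, v) \<in> R}"]
  by (auto simp: relation_ideal_def free_algebra_def)

text \<open>The preimage of an ideal under the homomorphism \<open>subst f\<close> is an ideal. It
  contains the generators of \<open>relation_ideal R\<close>, hence all of it by minimality.\<close>

lemma subst_relation_ideal:
  assumes rels: "\<And>u v. (u, v) \<in> R \<Longrightarrow> subst f u - subst f v \<in> relation_ideal S"
    and x: "x \<in> relation_ideal R"
  shows "subst f x \<in> relation_ideal S"
proof -
  let ?J = "{x. subst f x \<in> relation_ideal S}"
  let ?F = "free_algebra :: ('b, 'a list \<Rightarrow>\<^sub>0 'b) module"
  have inv: "\<ominus>\<^bsub>?F\<^esub> x = - x" for x
  proof -
    interpret ring ?F by (rule ring_free_algebra)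
    show ?thesis by (rule minus_equality) (auto simp: free_algebra_def)
  qed
  have "ideal ?J ?F"
  proof (rule idealI[OF ring_free_algebra])
    show "subgroup ?J (add_monoid ?F)"
    proof
      fix x assume "x \<in> ?J"
      moreover have "inv\<^bsub>add_monoid ?F\<^esub> x = - x"
        using inv[of x] by (simp add: a_inv_def)
      ultimately show "inv\<^bsub>add_monoid ?F\<^esub> x \<in> ?J" by (simp add: relation_ideal_uminus)
    qed (auto simp: free_algebra_def relation_ideal_zero intro: relation_ideal_closed)
  qed (auto simp: free_algebra_def intro: relation_ideal_closed)
  moreover have "{u - v | u v. (u, v) \<in> R} \<subseteq> ?J"
    using rels by auto
  ultimately have "relation_ideal R \<subseteq> ?J"
    unfolding relation_ideal_def by (rule ring.genideal_minimal[OF ring_free_algebra])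
  thus ?thesis using x by blast
qed

lemma subst_inverse_mod:
  assumes gen: "\<And>x. subst g (f x) - gen x \<in> relation_ideal R"
  shows "subst g (subst f u) - u \<in> relation_ideal R"
proof (induction u rule: free_algebra_induct)
  case (add u v)
  from relation_ideal_add[OF this] show ?case by (simp add: algebra_simps)
next
  case (mult u v)
  \<comment> \<open>Telescoping: one factor is replaced at a time, so each summand contains a
    difference covered by an induction hypothesis.\<close>
  have "subst g (subst f (u * v)) - u * v =
      (subst g (subst f u) - u) * subst g (subst f v) + u * (subst g (subst f v) - v)"
    by (simp add: algebra_simps)
  also have "\<dots> \<in> relation_ideal R"
    using mult
    by (intro relation_ideal_add) (simp_all add: relation_ideal_mult_left relation_ideal_mult_right)
  finally show ?case .
qed (simp_all add: gen relation_ideal_zero)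

text \<open>Substitutions that respect the relations descend to the quotients; being mutually
  inverse there need only be tested on generators.\<close>

lemma presented_algebra_isoI:
  assumes f: "\<And>u v. (u, v) \<in> R \<Longrightarrow> subst f u - subst f v \<in> relation_ideal S"
    and g: "\<And>u v. (u, v) \<in> S \<Longrightarrow> subst g u - subst g v \<in> relation_ideal R"
    and gf: "\<And>x. subst g (f x) - gen x \<in> relation_ideal R"
    and fg: "\<And>y. subst f (g y) - gen y \<in> relation_ideal S"
  shows "\<exists>\<phi>\<in>algebra_iso (presented_algebra R) (presented_algebra S).
    \<forall>u. \<phi> (rel_class R u) = rel_class S (subst f u)"
proof -
  \<comment> \<open>A representative of the class is chosen; the next claim shows that the choice
    does not affect the value.\<close>
  define \<phi> where "\<phi> K = rel_class S (subst f (SOME u. rel_class R u = K))" for K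
  have \<phi>: "\<phi> (rel_class R u) = rel_class S (subst f u)" for u
  proof -
    have "rel_class R (SOME v. rel_class R v = rel_class R u) = rel_class R u"
      by (rule someI_ex) blast
    hence "(SOME v. rel_class R v = rel_class R u) - u \<in> relation_ideal R"
      by (simp add: rel_class_eq_iff)
    from subst_relation_ideal[OF f this] show ?thesis
      by (simp add: \<phi>_def rel_class_eq_iff)
  qed
  have "inj_on \<phi> (carrier (presented_algebra R))"
  proof (rule inj_onI, clarsimp simp: carrier_presented_algebra \<phi> rel_class_eq_iff)
    fix u v assume "subst f u - subst f v \<in> relation_ideal S"
    hence "subst f (u - v) \<in> relation_ideal S" by simp
    \<comment> \<open>Injectivity: applying \<open>subst g\<close> yields an element of the ideal of
      \<open>R\<close> that is congruent to \<open>u - v\<close>.\<close>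
    from relation_ideal_diff[OF subst_relation_ideal[OF g this] subst_inverse_mod[OF gf]]
    have "subst g (subst f (u - v)) - (subst g (subst f (u - v)) - (u - v)) \<in> relation_ideal R" .
    thus "u - v \<in> relation_ideal R" by simp
  qed
  moreover have "\<phi> ` carrier (presented_algebra R) = carrier (presented_algebra S)"
  proof -
    have "\<phi> (rel_class R (subst g v)) = rel_class S v" for v
      by (simp add: \<phi> rel_class_eq_iff subst_inverse_mod[OF fg])
    thus ?thesis by (auto simp: carrier_presented_algebra \<phi> image_iff) (metis)
  qed
  ultimately have "bij_betw \<phi> (carrier (presented_algebra R)) (carrier (presented_algebra S))"
    by (simp add: bij_betw_def)
  hence "\<phi> \<in> algebra_iso (presented_algebra R) (presented_algebra S)"
    by (auto simp: algebra_iso_def ring_iso_def ring_hom_def carrier_presented_algebra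
        presented_algebra_ops \<phi> subst_scale)
  thus ?thesis using \<phi> by blast
qed

section \<open>The Racah algebra\<close>

definition to_racah :: "pres_gen \<Rightarrow> (racah_gen list \<Rightarrow>\<^sub>0 'k::field)"
  where "to_racah x = (case x of hA \<Rightarrow> rA | hB \<Rightarrow> rB | hC \<Rightarrow> rC | hD \<Rightarrow> rD | h\<alpha> \<Rightarrow> r\<alpha> | h\<beta> \<Rightarrow> r\<beta>)"

definition of_racah :: "racah_gen \<Rightarrow> (pres_gen list \<Rightarrow>\<^sub>0 'k::field)"
  where "of_racah y = (case y of gA \<Rightarrow> pA | gB \<Rightarrow> pB | gC \<Rightarrow> pC | gD \<Rightarrow> pD)"

lemma subst_commutator [simp]: "subst f (commutator u v) = commutator (subst f u) (subst f v)"
  by (simp add: commutator_def)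

lemma to_racah_relations:
  assumes "(u, v) \<in> pres_relations"
  shows "subst to_racah u - subst to_racah v \<in> relation_ideal racah_relations"
proof -
  have "commutator rA rB - 2 * rD \<in> relation_ideal racah_relations"
    "commutator rB rC - 2 * rD \<in> relation_ideal racah_relations"
    and "commutator rC rA - 2 * rD \<in> relation_ideal racah_relations"
    and central: "\<And>x. r\<alpha> * x - x * r\<alpha> \<in> relation_ideal racah_relations"
    "\<And>x. r\<beta> * x - x * r\<beta> \<in> relation_ideal racah_relations"
    by (auto intro!: relation_ideal_rel simp: racah_relations_def)
  from this(1,2)[THEN relation_ideal_uminus] this(3)
  have comm: "rB * rA - (rA * rB - 2 * rD) \<in> relation_ideal racah_relations"
    "rC * rB - (rB * rC - 2 * rD) \<in> relation_ideal racah_relations"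
    "rC * rA - (rA * rC + 2 * rD) \<in> relation_ideal racah_relations"
    by (simp_all add: commutator_def algebra_simps)
  \<comment> \<open>The relations for DA and DB become identities of the free algebra once \<alpha>
    and \<beta> are replaced by their defining expressions.\<close>
  have eq: "rA * rD - rB * rA + rA * rC - r\<alpha> = rD * rA" "rB * rD - rC * rB + rB * rA - r\<beta> = rD * rB"
    by (simp_all add: r\<alpha>_def r\<beta>_def commutator_def)
  show ?thesis
    using assms comm central
    by (auto simp: pres_relations_def to_racah_def eq relation_ideal_zero)
qed

section \<open>Centralizers modulo a relation ideal\<close>

definition centralizer_mod ::
    "(('g list \<Rightarrow>\<^sub>0 'k::field) \<times> ('g list \<Rightarrow>\<^sub>0 'k)) set \<Rightarrow> ('g list \<Rightarrow>\<^sub>0 'k) \<Rightarrow> ('g list \<Rightarrow>\<^sub>0 'k) set"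
  where "centralizer_mod R z = {x. commutator z x \<in> relation_ideal R}"

lemma centralizer_mod_add:
  "x \<in> centralizer_mod R z \<Longrightarrow> y \<in> centralizer_mod R z \<Longrightarrow> x + y \<in> centralizer_mod R z"
  using relation_ideal_add[of "commutator z x" R "commutator z y"]
  by (simp add: centralizer_mod_def commutator_def algebra_simps)

text \<open>The commutator with \<open>z\<close> is a derivation, so by the Leibniz rule the
  centralizer is a subalgebra.\<close>

lemma centralizer_mod_mult:
  assumes "x \<in> centralizer_mod R z" "y \<in> centralizer_mod R z"
  shows "x * y \<in> centralizer_mod R z"
proof -
  have "commutator z (x * y) = commutator z x * y + x * commutator z y"
    by (simp add: commutator_def algebra_simps)
  thus ?thesis
    using assms by (simp add: centralizer_mod_def relation_ideal_add relation_ideal_mult)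
qed

lemma centralizer_mod_const: "Poly_Mapping.single 0 c \<in> centralizer_mod R z"
  using single_zero_commute[of c z]
  by (simp add: centralizer_mod_def commutator_def relation_ideal_zero)

lemma centralizer_mod_uminus: "x \<in> centralizer_mod R z \<Longrightarrow> - x \<in> centralizer_mod R z"
  using relation_ideal_uminus[of "commutator z x" R]
  by (simp add: centralizer_mod_def commutator_def)

lemma centralizer_mod_diff:
  "x \<in> centralizer_mod R z \<Longrightarrow> y \<in> centralizer_mod R z \<Longrightarrow> x - y \<in> centralizer_mod R z"
  using centralizer_mod_add[OF _ centralizer_mod_uminus, of x R z y] by simp

text \<open>Elements of the ideal vanish in the quotient. Thus the defining relations can be used to
  rewrite members of a centralizer.\<close>

lemma centralizer_mod_relation_ideal: "x \<in> relation_ideal R \<Longrightarrow> x \<in> centralizer_mod R z"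
  by (simp add: centralizer_mod_def commutator_def relation_ideal_diff relation_ideal_mult)

text \<open>The characteristic enters here: the scalar 1/2 exists and lies in every
  centralizer.\<close>

lemma centralizer_mod_half:
  fixes x :: "'g list \<Rightarrow>\<^sub>0 'k::field"
  assumes "(2 :: 'k) \<noteq> 0" "2 * x \<in> centralizer_mod R z"
  shows "x \<in> centralizer_mod R z"
proof -
  have "Poly_Mapping.single 0 (1 / 2) * (2 * x) = (Poly_Mapping.single 0 (1 / 2) * 2) * x"
    by (simp add: mult.assoc)
  also have "Poly_Mapping.single 0 (1 / 2) * (2 :: 'g list \<Rightarrow>\<^sub>0 'k) = 1"
    using assms(1) mult_single[of "0 :: 'g list" "1 / 2" 0 "2 :: 'k"] by simp
  finally show ?thesis
    using centralizer_mod_mult[OF centralizer_mod_const assms(2), of "1 / 2"] by simp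
qed

lemma centralizer_mod_UNIV:
  assumes "\<And>g. gen g \<in> centralizer_mod R z"
  shows "x \<in> centralizer_mod R z"
  by (induction x rule: free_algebra_induct)
     (simp_all add: assms centralizer_mod_const centralizer_mod_add centralizer_mod_mult)

text \<open>Extends commutation with A, B, C to the whole algebra by solving the relations
  successively for 2D, \<alpha> and \<beta>.\<close>

lemma pres_central:
  fixes z :: "pres_gen list \<Rightarrow>\<^sub>0 'k::field"
  assumes "(2 :: 'k) \<noteq> 0"
    and ABC: "pA \<in> centralizer_mod pres_relations z" "pB \<in> centralizer_mod pres_relations z"
      "pC \<in> centralizer_mod pres_relations z"
  shows "x \<in> centralizer_mod pres_relations z"
proof -
  let ?Z = "centralizer_mod pres_relations z"
  note closed = centralizer_mod_diff centralizer_mod_add centralizer_mod_mult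
  have rel: "u - v \<in> ?Z" if "(u, v) \<in> pres_relations" for u v
    using that by (intro centralizer_mod_relation_ideal relation_ideal_rel)
  \<comment> \<open>An expression already known to lie in the centralizer plus a defining
    difference; the sum collapses to \<open>2 * pD\<close>. The same device yields
    \<open>p\<alpha>\<close> and \<open>p\<beta>\<close> below.\<close>
  have "pA * pB - pB * pA + (pB * pA - (pA * pB - 2 * pD)) \<in> ?Z"
    by (rule centralizer_mod_add[OF _ rel]) (intro closed ABC, simp add: pres_relations_def)
  hence "2 * pD \<in> ?Z" by simp
  with assms(1) have D: "pD \<in> ?Z" by (rule centralizer_mod_half)
  have "pA * pD - pB * pA + pA * pC - pD * pA
      + (pD * pA - (pA * pD - pB * pA + pA * pC - p\<alpha>)) \<in> ?Z"
    by (rule centralizer_mod_add[OF _ rel]) (intro closed ABC D, simp add: pres_relations_def)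
  hence \<alpha>: "p\<alpha> \<in> ?Z" by simp
  have "pB * pD - pC * pB + pB * pA - pD * pB
      + (pD * pB - (pB * pD - pC * pB + pB * pA - p\<beta>)) \<in> ?Z"
    by (rule centralizer_mod_add[OF _ rel]) (intro closed ABC D, simp add: pres_relations_def)
  hence \<beta>: "p\<beta> \<in> ?Z" by simp
  have "gen g \<in> ?Z" for g
    by (cases g) (simp_all add: ABC D \<alpha> \<beta>)
  thus ?thesis by (rule centralizer_mod_UNIV)
qed

text \<open>The substantial direction: the target presentation postulates only that \<alpha> and
  \<beta> commute with A, B, C, whereas centrality against every element, and that of \<gamma>, must
  be derived.\<close>

lemma of_racah_relations:
  fixes u v :: "racah_gen list \<Rightarrow>\<^sub>0 'k::field"
  assumes two: "(2 :: 'k) \<noteq> 0" and "(u, v) \<in> racah_relations"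
  shows "subst of_racah u - subst of_racah v \<in> relation_ideal pres_relations"
proof -
  let ?I = "relation_ideal pres_relations :: (pres_gen list \<Rightarrow>\<^sub>0 'k) set"
  let ?Z = "centralizer_mod pres_relations ::
    (pres_gen list \<Rightarrow>\<^sub>0 'k) \<Rightarrow> (pres_gen list \<Rightarrow>\<^sub>0 'k) set"
  have comm: "pB * pA - (pA * pB - 2 * pD) \<in> ?I" "pC * pB - (pB * pC - 2 * pD) \<in> ?I"
    "pC * pA - (pA * pC + 2 * pD) \<in> ?I"
    and def: "pD * pA - (pA * pD - pB * pA + pA * pC - p\<alpha>) \<in> ?I"
    "pD * pB - (pB * pD - pC * pB + pB * pA - p\<beta>) \<in> ?I"
    by (intro relation_ideal_rel; simp add: pres_relations_def)+
  have comm': "commutator pA pB - 2 * pD \<in> ?I" "commutator pB pC - 2 * pD \<in> ?I"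
    "commutator pC pA - 2 * pD \<in> ?I"
    using comm(1,2)[THEN relation_ideal_uminus] comm(3)
    by (simp_all add: commutator_def algebra_simps)
  have \<alpha>: "x \<in> ?Z p\<alpha>" for x
    by (rule pres_central[OF two]; unfold centralizer_mod_def mem_Collect_eq commutator_def,
        rule relation_ideal_rel, simp add: pres_relations_def)
  have \<beta>: "x \<in> ?Z p\<beta>" for x
    by (rule pres_central[OF two]; unfold centralizer_mod_def mem_Collect_eq commutator_def,
        rule relation_ideal_rel, simp add: pres_relations_def)
  \<comment> \<open>Modulo the ideal the commutators [A,B], [B,C], [C,A] coincide, and [A+B+C,A] =
    [C,A] - [A,B]; the cases of B and C are cyclic.\<close>
  have S: "x \<in> ?Z (pA + pB + pC)" for x
  proof (rule pres_central[OF two])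
    show "pA \<in> ?Z (pA + pB + pC)"
      using relation_ideal_diff[OF comm'(3,1)]
      by (simp add: centralizer_mod_def commutator_def algebra_simps)
    show "pB \<in> ?Z (pA + pB + pC)"
      using relation_ideal_diff[OF comm'(1,2)]
      by (simp add: centralizer_mod_def commutator_def algebra_simps)
    show "pC \<in> ?Z (pA + pB + pC)"
      using relation_ideal_diff[OF comm'(2,3)]
      by (simp add: centralizer_mod_def commutator_def algebra_simps)
  qed
  \<comment> \<open>Centralizers depend only on the class of \<open>z\<close>, so centrality passes
    from the generators \<open>p\<alpha>\<close>, \<open>p\<beta>\<close> to the images of
    \<open>r\<alpha>\<close>, \<open>r\<beta>\<close>.\<close>
  have cong: "x \<in> ?Z z" if "z - w \<in> ?I" "x \<in> ?Z w" for x z w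
  proof -
    have "commutator z x = commutator w x + ((z - w) * x - x * (z - w))"
      by (simp add: commutator_def algebra_simps)
    also have "\<dots> \<in> ?I"
      using that unfolding centralizer_mod_def mem_Collect_eq
      by (intro relation_ideal_add[OF _ relation_ideal_diff]) (simp_all only: relation_ideal_mult)
    finally show ?thesis by (simp add: centralizer_mod_def)
  qed
  have \<alpha>': "x \<in> ?Z (subst of_racah r\<alpha>)" for x
    by (rule cong[OF _ \<alpha>], use def(1)[THEN relation_ideal_uminus] in
        \<open>simp add: r\<alpha>_def of_racah_def commutator_def algebra_simps\<close>)
  have \<beta>': "x \<in> ?Z (subst of_racah r\<beta>)" for x
    by (rule cong[OF _ \<beta>], use def(2)[THEN relation_ideal_uminus] in
        \<open>simp add: r\<beta>_def of_racah_def commutator_def algebra_simps\<close>)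
  have \<gamma>': "x \<in> ?Z (subst of_racah r\<gamma>)" for x
  proof (rule cong)
    \<comment> \<open>The quadratic terms of \<alpha> + \<beta> + \<gamma> cancel in pairs, so this
      difference is exactly [A+B+C,D].\<close>
    show "subst of_racah r\<gamma> - (- subst of_racah r\<alpha> - subst of_racah r\<beta>) \<in> ?I"
      using S[of pD]
      by (simp add: centralizer_mod_def r\<alpha>_def r\<beta>_def r\<gamma>_def of_racah_def commutator_def
          algebra_simps)
    show "x \<in> ?Z (- subst of_racah r\<alpha> - subst of_racah r\<beta>)"
    proof -
      have "commutator (- a - b) x = - (commutator a x + commutator b x)"
        for a b :: "pres_gen list \<Rightarrow>\<^sub>0 'k"
        by (simp add: commutator_def algebra_simps)
      thus ?thesis
        using relation_ideal_uminus[OF relation_ideal_add] \<alpha>'[of x] \<beta>'[of x]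
        by (simp only: centralizer_mod_def mem_Collect_eq)
    qed
  qed
  show ?thesis
    using assms(2) comm' \<alpha>' \<beta>' \<gamma>'
    by (auto simp: racah_relations_def centralizer_mod_def commutator_def of_racah_def)
qed

theorem proposition3p3:
  assumes "CHAR('k::field) \<noteq> 2"
  shows "\<exists>\<phi> \<in> algebra_iso (pres_algebra :: ('k, (pres_gen list \<Rightarrow>\<^sub>0 'k) set) module) racah_algebra.
    \<phi> (rel_class pres_relations pA) = rel_class racah_relations rA \<and>
    \<phi> (rel_class pres_relations pB) = rel_class racah_relations rB \<and>
    \<phi> (rel_class pres_relations pC) = rel_class racah_relations rC \<and>
    \<phi> (rel_class pres_relations pD) = rel_class racah_relations rD \<and>
    \<phi> (rel_class pres_relations p\<alpha>) = rel_class racah_relations r\<alpha> \<and>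
    \<phi> (rel_class pres_relations p\<beta>) = rel_class racah_relations r\<beta>"
proof -
  have two: "(2 :: 'k) \<noteq> 0"
  proof
    assume "(2 :: 'k) = 0"
    hence "CHAR('k) dvd 2" using of_nat_eq_0_iff_char_dvd[of 2, where 'a = 'k] by simp
    hence "CHAR('k) = 1 \<or> CHAR('k) = 2" using two_is_prime_nat unfolding prime_nat_iff by blast
    \<comment> \<open>Characteristic 1 is impossible because 0 and 1 differ in a field.\<close>
    thus False using assms by simp
  qed
  \<comment> \<open>The composite fixes A, B, C, D exactly; it fixes \<alpha> and \<beta> only
    modulo the relations for DA and DB. The opposite composite fixes every generator
    exactly.\<close>
  have "subst of_racah (to_racah x) - gen x \<in>
      (relation_ideal pres_relations :: (pres_gen list \<Rightarrow>\<^sub>0 'k) set)" for x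
  proof -
    have "- (pD * pA - (pA * pD - pB * pA + pA * pC - p\<alpha>)) \<in>
        (relation_ideal pres_relations :: (pres_gen list \<Rightarrow>\<^sub>0 'k) set)"
      "- (pD * pB - (pB * pD - pC * pB + pB * pA - p\<beta>)) \<in>
        (relation_ideal pres_relations :: (pres_gen list \<Rightarrow>\<^sub>0 'k) set)"
      by (intro relation_ideal_uminus relation_ideal_rel; simp add: pres_relations_def)+
    thus ?thesis
      by (cases x) (simp_all add: to_racah_def of_racah_def r\<alpha>_def r\<beta>_def commutator_def
          relation_ideal_zero algebra_simps)
  qed
  moreover have "subst to_racah (of_racah y) - gen y \<in>
      (relation_ideal racah_relations :: (racah_gen list \<Rightarrow>\<^sub>0 'k) set)" for y
    by (cases y) (simp_all add: to_racah_def of_racah_def relation_ideal_zero)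
  ultimately have "\<exists>\<phi>\<in>algebra_iso
      (pres_algebra :: ('k, (pres_gen list \<Rightarrow>\<^sub>0 'k) set) module) racah_algebra.
    \<forall>u. \<phi> (rel_class pres_relations u) = rel_class racah_relations (subst to_racah u)"
    unfolding pres_algebra_def racah_algebra_def
    by (intro presented_algebra_isoI[OF to_racah_relations of_racah_relations[OF two]])
  then obtain \<phi> where "\<phi> \<in> algebra_iso
      (pres_algebra :: ('k, (pres_gen list \<Rightarrow>\<^sub>0 'k) set) module) racah_algebra"
    and "\<And>u. \<phi> (rel_class pres_relations u) = rel_class racah_relations (subst to_racah u)"
    by blast
  thus ?thesis by (intro bexI[of _ \<phi>]) (simp_all add: to_racah_def)
qed

end
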